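(* Let $(A_1,\cdot_1,[\cdot,\cdot,\cdot]_1)$ and $(A_2,\cdot_2,[\cdot,\cdot,\cdot]_2)$ be two (finite-dimensional) Poisson 3-Lie algebras over a field $\mathbb F$ of characteristic zero. For $x_i\in A_1$, $y_i\in A_2$, define linear maps $\cdot_{A_1\oplus A_2}:\otimes^2(A_1\oplus A_2)\to A_1\oplus A_2$ and $[\cdot,\cdot,\cdot]_{A_1\oplus A_2}:\otimes^3(A_1\oplus A_2)\to A_1\oplus A_2$ by $$(x_1+y_1)\cdot_{A_1\oplus A_2}(x_2+y_2)=x_1\cdot_1x_2+y_1\cdot_2y_2,$$ $$[x_1+y_1,x_2+y_2,x_3+y_3]_{A_1\oplus A_2}=[x_1,x_2,x_3]_1+[y_1,y_2,y_3]_2.$$ Then $(A_1\oplus A_2,\cdot_{A_1\oplus A_2},[\cdot,\cdot,\cdot]_{A_1\oplus A_2})$ is a Poisson 3-Lie algebra.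
   Context: A 3-Lie algebra is a vector space with a skew-symmetric trilinear bracket satisfying $[x_1,x_2,[x_3,x_4,x_5]]=[[x_1,x_2,x_3],x_4,x_5]+[x_3,[x_1,x_2,x_4],x_5]+[x_3,x_4,[x_1,x_2,x_5]]$. A Poisson 3-Lie algebra is a triple $(A,\cdot,[\cdot,\cdot,\cdot])$ where $(A,\cdot)$ is a commutative associative algebra (no unit assumed), $(A,[\cdot,\cdot,\cdot])$ is a 3-Lie algebra, and $[w\cdot x,y,z]=w\cdot[x,y,z]+x\cdot[w,y,z]$ for all $x,y,z,w\in A$. *)

theory Defs
  imports "HOL-Analysis.Product_Vector"
begin

text \<open>
  The bracket of a 3-Lie algebra is trilinear. Adjacent transpositions generate the symmetric
  group on the three arguments, so the two sign rules give skew-symmetry under every permutation.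
\<close>

locale three_lie_algebra = vector_space scale
  for scale :: "'f::field_char_0 \<Rightarrow> 'a::ab_group_add \<Rightarrow> 'a" +
  fixes bracket :: "'a \<Rightarrow> 'a \<Rightarrow> 'a \<Rightarrow> 'a"
  assumes bracket_linear_1: "Vector_Spaces.linear scale scale (\<lambda>x. bracket x y z)"
    and bracket_linear_2: "Vector_Spaces.linear scale scale (\<lambda>y. bracket x y z)"
    and bracket_linear_3: "Vector_Spaces.linear scale scale (\<lambda>z. bracket x y z)"
    and bracket_skew_12: "bracket y x z = - bracket x y z"
    and bracket_skew_23: "bracket x z y = - bracket x y z"
    and fundamental_identity:
      "bracket x1 x2 (bracket x3 x4 x5) =
        bracket (bracket x1 x2 x3) x4 x5
        + bracket x3 (bracket x1 x2 x4) x5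
        + bracket x3 x4 (bracket x1 x2 x5)"

locale comm_assoc_algebra = vector_space scale
  for scale :: "'f::field_char_0 \<Rightarrow> 'a::ab_group_add \<Rightarrow> 'a" +
  fixes mult :: "'a \<Rightarrow> 'a \<Rightarrow> 'a"
  assumes mult_linear_1: "Vector_Spaces.linear scale scale (\<lambda>x. mult x y)"
    and mult_linear_2: "Vector_Spaces.linear scale scale (\<lambda>y. mult x y)"
    and mult_assoc: "mult (mult x y) z = mult x (mult y z)"
    and mult_commute: "mult x y = mult y x"

locale poisson_three_lie_algebra =
  comm_assoc_algebra scale mult + three_lie_algebra scale bracket
  for scale :: "'f::field_char_0 \<Rightarrow> 'a::ab_group_add \<Rightarrow> 'a"
    and mult :: "'a \<Rightarrow> 'a \<Rightarrow> 'a"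
    and bracket :: "'a \<Rightarrow> 'a \<Rightarrow> 'a \<Rightarrow> 'a" +
  assumes leibniz: "bracket (mult w x) y z = mult w (bracket x y z) + mult x (bracket w y z)"

text \<open>
  The direct sum is the product type, with \<open>x + y\<close> (\<open>x\<close> in the first summand, \<open>y\<close> in the second)
  represented by \<open>(x, y)\<close> and scalars acting through \<open>module_prod.scale\<close>.
\<close>

definition direct_sum_mult ::
  "('a \<Rightarrow> 'a \<Rightarrow> 'a) \<Rightarrow> ('b \<Rightarrow> 'b \<Rightarrow> 'b) \<Rightarrow> 'a \<times> 'b \<Rightarrow> 'a \<times> 'b \<Rightarrow> 'a \<times> 'b"
  where "direct_sum_mult mult1 mult2 u v = (mult1 (fst u) (fst v), mult2 (snd u) (snd v))"

definition direct_sum_bracket ::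
  "('a \<Rightarrow> 'a \<Rightarrow> 'a \<Rightarrow> 'a) \<Rightarrow> ('b \<Rightarrow> 'b \<Rightarrow> 'b \<Rightarrow> 'b)
    \<Rightarrow> 'a \<times> 'b \<Rightarrow> 'a \<times> 'b \<Rightarrow> 'a \<times> 'b \<Rightarrow> 'a \<times> 'b"
  where "direct_sum_bracket br1 br2 u v w =
    (br1 (fst u) (fst v) (fst w), br2 (snd u) (snd v) (snd w))"

end

theory Submission
  imports Defs
begin

text \<open>The operations on the sum act separately on the two coordinates, with no cross terms,
  and the vector space structure of the product is coordinatewise too. Every axiom is an identity or
  a linearity condition, so it holds in the product once it holds in each coordinate, where it is
  the same axiom of a summand. \<open>linear_map_prod\<close> carries the linearity axioms; the
  identities follow by comparing coordinates. The locale hierarchy dictates the division: the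
  product, the bracket, then the Leibniz rule that links them. Finite dimension comes from joining
  bases of the two summands.\<close>

text \<open>Addition and scaling on pairs are coordinatewise. Fixing all arguments but one of a
  direct sum operation leaves a \<open>map_prod\<close> of two partial maps, so this single fact
  gives linearity in every slot of both operations.\<close>

lemma (in vector_space_prod) linear_map_prod:
  assumes "Vector_Spaces.linear s1 s1 f" and "Vector_Spaces.linear s2 s2 g"
  shows "Vector_Spaces.linear scale scale (map_prod f g)"
  using assms by (auto simp: Vector_Spaces.linear_iff scale_def p.vector_space_axioms)

lemma comm_assoc_algebra_direct_sum:
  assumes "comm_assoc_algebra s1 mult1" and "comm_assoc_algebra s2 mult2"
  shows "comm_assoc_algebra (module_prod.scale s1 s2) (direct_sum_mult mult1 mult2)"
proof -
  interpret A: comm_assoc_algebra s1 mult1 by fact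
  interpret B: comm_assoc_algebra s2 mult2 by fact
  interpret vector_space_prod s1 s2 by unfold_locales
  let ?m = "direct_sum_mult mult1 mult2"
  show ?thesis
  proof (intro comm_assoc_algebra.intro comm_assoc_algebra_axioms.intro p.vector_space_axioms)
    fix u v w
    show "Vector_Spaces.linear scale scale (\<lambda>x. ?m x v)"
      using linear_map_prod[OF A.mult_linear_1 B.mult_linear_1]
      by (simp add: direct_sum_mult_def map_prod_def split_def)
    show "Vector_Spaces.linear scale scale (\<lambda>y. ?m u y)"
      using linear_map_prod[OF A.mult_linear_2 B.mult_linear_2]
      by (simp add: direct_sum_mult_def map_prod_def split_def)
    show "?m (?m u v) w = ?m u (?m v w)"
      by (simp add: direct_sum_mult_def A.mult_assoc B.mult_assoc)
    show "?m u v = ?m v u"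
      by (simp add: direct_sum_mult_def A.mult_commute B.mult_commute)
  qed
qed

lemma three_lie_algebra_direct_sum:
  assumes "three_lie_algebra s1 bracket1" and "three_lie_algebra s2 bracket2"
  shows "three_lie_algebra (module_prod.scale s1 s2) (direct_sum_bracket bracket1 bracket2)"
proof -
  interpret A: three_lie_algebra s1 bracket1 by fact
  interpret B: three_lie_algebra s2 bracket2 by fact
  interpret vector_space_prod s1 s2 by unfold_locales
  let ?b = "direct_sum_bracket bracket1 bracket2"
  show ?thesis
  proof (intro three_lie_algebra.intro three_lie_algebra_axioms.intro p.vector_space_axioms)
    fix u v w x y
    show "Vector_Spaces.linear scale scale (\<lambda>x. ?b x v w)"
      using linear_map_prod[OF A.bracket_linear_1 B.bracket_linear_1]
      by (simp add: direct_sum_bracket_def map_prod_def split_def)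
    show "Vector_Spaces.linear scale scale (\<lambda>y. ?b u y w)"
      using linear_map_prod[OF A.bracket_linear_2 B.bracket_linear_2]
      by (simp add: direct_sum_bracket_def map_prod_def split_def)
    show "Vector_Spaces.linear scale scale (\<lambda>z. ?b u v z)"
      using linear_map_prod[OF A.bracket_linear_3 B.bracket_linear_3]
      by (simp add: direct_sum_bracket_def map_prod_def split_def)
    \<comment> \<open>The axiom is applied just once per coordinate: as a rewrite rule it would
      apply again to its own right-hand side.\<close>
    show "?b v u w = - ?b u v w"
      unfolding direct_sum_bracket_def
      by (intro prod_eqI; simp; rule A.bracket_skew_12 B.bracket_skew_12)
    show "?b u w v = - ?b u v w"
      unfolding direct_sum_bracket_def
      by (intro prod_eqI; simp; rule A.bracket_skew_23 B.bracket_skew_23)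
    \<comment> \<open>Again a single application per coordinate, since the last summand on the right
      has the shape of the left-hand side.\<close>
    show "?b u v (?b w x y) = ?b (?b u v w) x y + ?b w (?b u v x) y + ?b w x (?b u v y)"
      unfolding direct_sum_bracket_def
      by (intro prod_eqI; simp; rule A.fundamental_identity B.fundamental_identity)
  qed
qed

lemma poisson_three_lie_algebra_direct_sum:
  assumes "poisson_three_lie_algebra s1 mult1 bracket1"
    and "poisson_three_lie_algebra s2 mult2 bracket2"
  shows "poisson_three_lie_algebra (module_prod.scale s1 s2)
    (direct_sum_mult mult1 mult2) (direct_sum_bracket bracket1 bracket2)"
proof -
  interpret A: poisson_three_lie_algebra s1 mult1 bracket1 by fact
  interpret B: poisson_three_lie_algebra s2 mult2 bracket2 by fact
  interpret vector_space_prod s1 s2 by unfold_locales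
  interpret comm_assoc_algebra scale "direct_sum_mult mult1 mult2"
    by (rule comm_assoc_algebra_direct_sum) unfold_locales
  interpret three_lie_algebra scale "direct_sum_bracket bracket1 bracket2"
    by (rule three_lie_algebra_direct_sum) unfold_locales
  \<comment> \<open>With both parent structures interpreted, only the Leibniz rule is left, and it
    splits into the rules of the two summands.\<close>
  show ?thesis
    by unfold_locales
      (simp add: direct_sum_mult_def direct_sum_bracket_def A.leibniz B.leibniz)
qed

theorem proposition3p1:
  fixes scale1 :: "'f::field_char_0 \<Rightarrow> 'a::ab_group_add \<Rightarrow> 'a"
    and scale2 :: "'f \<Rightarrow> 'b::ab_group_add \<Rightarrow> 'b"
    and mult1 :: "'a \<Rightarrow> 'a \<Rightarrow> 'a" and bracket1 :: "'a \<Rightarrow> 'a \<Rightarrow> 'a \<Rightarrow> 'a"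
    and mult2 :: "'b \<Rightarrow> 'b \<Rightarrow> 'b" and bracket2 :: "'b \<Rightarrow> 'b \<Rightarrow> 'b \<Rightarrow> 'b"
  assumes "poisson_three_lie_algebra scale1 mult1 bracket1"
    and "\<exists>B1. finite_dimensional_vector_space scale1 B1"
    and "poisson_three_lie_algebra scale2 mult2 bracket2"
    and "\<exists>B2. finite_dimensional_vector_space scale2 B2"
  shows "poisson_three_lie_algebra (module_prod.scale scale1 scale2)
           (direct_sum_mult mult1 mult2) (direct_sum_bracket bracket1 bracket2)
         \<and> (\<exists>B. finite_dimensional_vector_space (module_prod.scale scale1 scale2) B)"
proof
  interpret A: poisson_three_lie_algebra scale1 mult1 bracket1 by fact
  interpret B: poisson_three_lie_algebra scale2 mult2 bracket2 by fact
  interpret vector_space_prod scale1 scale2 by unfold_locales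
  show "poisson_three_lie_algebra (module_prod.scale scale1 scale2)
      (direct_sum_mult mult1 mult2) (direct_sum_bracket bracket1 bracket2)"
    using assms(1,3) by (rule poisson_three_lie_algebra_direct_sum)
  obtain B1 B2 where "finite_dimensional_vector_space scale1 B1"
    and "finite_dimensional_vector_space scale2 B2"
    using assms(2,4) by blast
  \<comment> \<open>The finite basis of the product consists of the pairs \<open>(b, 0)\<close> with
    \<open>b\<close> in \<open>B1\<close> and \<open>(0, b)\<close> with \<open>b\<close> in
    \<open>B2\<close>.\<close>
  then interpret D: finite_dimensional_vector_space_prod scale1 scale2 B1 B2
    by (simp add: finite_dimensional_vector_space_prod_def
        finite_dimensional_vector_space_pair_def vector_space_prod_axioms)
  show "\<exists>B. finite_dimensional_vector_space (module_prod.scale scale1 scale2) B"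
    using D.p.finite_dimensional_vector_space_axioms by blast
qed

end
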